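(* Let $G$ be a simple graph with $v$ vertices and $|E|$ edges, let $p_0$ be the number of connected components of $G$, $p_0^{bi}$ the number of bipartite connected components of $G$, and $p_1=|E|-v+p_0$ the cyclomatic number of $G$. Then (0) $H^{0,v-1}_{\mathcal A_2}(G)\cong\mathbb Z^{p_0^{bi}}$; (1) $H^{1,v-1}_{\mathcal A_2}(G)\cong\mathbb Z^{p_1-(p_0-p_0^{bi})}\oplus\mathbb Z_2^{p_0-p_0^{bi}}$.
   Context: For $m\ge 2$ let $\mathcal A_m=\mathbb Z[x]/(x^m)$. For a finite graph $G$ with vertex set $V(G)$, edge set $E(G)$ (with a fixed total order), and $s\subseteq E(G)$, let $[G:s]$ be the spanning subgraph with edge set $s$. An enhanced state is a pair $(s,c)$ where $s\subseteq E(G)$ and $c$ assigns to each component $C$ of $[G:s]$ an exponent $c(C)\in\{0,\dots,m-1\}$ (weight $x^{c(C)}$); its bidegree is $(|s|,\sum_C c(C))$. $C^{i,j}_{\mathcal A_m}(G)$ is the free abelian group on enhanced states of bidegree $(i,j)$. The differential is $d=\sum_{e\notin s}(-1)^{|\{f\in s:f<e\}|}d_e$, where $d_e(s,c)$ is the enhanced state on $s\cup\{e\}$ obtained, if $e$ joins distinct components $C_1,C_2$, by giving the merged component the weight $x^{c(C_1)}x^{c(C_2)}\in\mathcal A_m$ (zero if the exponent sum is $\ge m$) and keeping other weights, and, if $e$ has both endpoints in one component, by keeping all weights (identity). $H^{i,j}_{\mathcal A_m}(G)$ is the resulting cohomology. *)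

theory Defs
  imports "HOL-Algebra.Algebra"
begin

text \<open>A finite simple graph is given by a finite vertex set V and a duplicate-free
list es of edges (two-element subsets of V); the list order is the fixed total
order on the edges. Edges are referred to by their indices 0..<length es.
An edge subset s is a set of indices.\<close>

definition simple_graph :: "'v set \<Rightarrow> 'v set list \<Rightarrow> bool" where
  "simple_graph V es \<longleftrightarrow> finite V \<and> distinct es \<and>
     (\<forall>e\<in>set es. e \<subseteq> V \<and> card e = 2)"

text \<open>Adjacency relation of the spanning subgraph [G:s].\<close>
definition adj :: "'v set list \<Rightarrow> nat set \<Rightarrow> ('v \<times> 'v) set" where
  "adj es s = {(a, b). \<exists>i\<in>s. i < length es \<and> es ! i = {a, b}}"

text \<open>Connectivity (equivalence relation on V) of [G:s].\<close>
definition conn :: "'v set \<Rightarrow> 'v set list \<Rightarrow> nat set \<Rightarrow> ('v \<times> 'v) set" where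
  "conn V es s = Restr ((adj es s)\<^sup>*) V"

text \<open>Connected components of [G:s].\<close>
definition comps :: "'v set \<Rightarrow> 'v set list \<Rightarrow> nat set \<Rightarrow> 'v set set" where
  "comps V es s = V // conn V es s"

text \<open>The component of [G:s] containing vertex a.\<close>
definition compo :: "'v set \<Rightarrow> 'v set list \<Rightarrow> nat set \<Rightarrow> 'v \<Rightarrow> 'v set" where
  "compo V es s a = conn V es s `` {a}"

text \<open>Enhanced states: an edge subset s together with exponents c C \<in> {0..m-1}
for each component C of [G:s] (c is extended by 0 outside the components, so that
the representation is canonical). The state of bidegree (i,j).\<close>
type_synonym 'v state = "nat set \<times> ('v set \<Rightarrow> nat)"

definition states :: "nat \<Rightarrow> 'v set \<Rightarrow> 'v set list \<Rightarrow> nat \<Rightarrow> int \<Rightarrow> 'v state set" where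
  "states m V es i j = {(s, c). s \<subseteq> {..<length es} \<and> card s = i \<and>
      (\<forall>C\<in>comps V es s. c C < m) \<and> (\<forall>C. C \<notin> comps V es s \<longrightarrow> c C = 0) \<and>
      int (\<Sum>C\<in>comps V es s. c C) = j}"

text \<open>The partial map d_e (None = zero): edge e added to state (s,c), e \<notin> s.\<close>
definition d_edge :: "nat \<Rightarrow> 'v set \<Rightarrow> 'v set list \<Rightarrow> nat \<Rightarrow> 'v state \<Rightarrow> 'v state option" where
  "d_edge m V es e x = (case x of (s, c) \<Rightarrow>
     (let a = SOME a. a \<in> es ! e; b = SOME b. b \<in> es ! e \<and> b \<noteq> a;
          C1 = compo V es s a; C2 = compo V es s b; s' = insert e s in
      if C1 = C2 then Some (s', c)
      else if c C1 + c C2 \<ge> m then None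
      else Some (s', ((c(C1 := 0))(C2 := 0))(C1 \<union> C2 := c C1 + c C2))))"

text \<open>Sign (-1)^{|{f \<in> s. f < e}|}.\<close>
definition dsign :: "nat set \<Rightarrow> nat \<Rightarrow> int" where
  "dsign s e = (-1) ^ card {f\<in>s. f < e}"

text \<open>Matrix coefficient of the differential: coefficient of state t in d(x).\<close>
definition dcoef :: "nat \<Rightarrow> 'v set \<Rightarrow> 'v set list \<Rightarrow> 'v state \<Rightarrow> 'v state \<Rightarrow> int" where
  "dcoef m V es x t = (\<Sum>e\<in>{..<length es} - fst x.
      if d_edge m V es e x = Some t then dsign (fst x) e else 0)"

text \<open>The cochain group C^{i,j}: the free abelian group on states of bidegree (i,j),
realised as integer-valued functions supported on these states.\<close>
definition cochain_group :: "nat \<Rightarrow> 'v set \<Rightarrow> 'v set list \<Rightarrow> nat \<Rightarrow> int \<Rightarrow> ('v state \<Rightarrow> int) monoid" where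
  "cochain_group m V es i j =
     \<lparr>carrier = {f. \<forall>x. x \<notin> states m V es i j \<longrightarrow> f x = 0},
      monoid.mult = (\<lambda>f g x. f x + g x), one = (\<lambda>x. 0)\<rparr>"

text \<open>The differential C^{i,j} \<rightarrow> C^{i+1,j}, extended linearly.\<close>
definition dmap :: "nat \<Rightarrow> 'v set \<Rightarrow> 'v set list \<Rightarrow> nat \<Rightarrow> int \<Rightarrow> ('v state \<Rightarrow> int) \<Rightarrow> ('v state \<Rightarrow> int)" where
  "dmap m V es i j f = (\<lambda>t. if t \<in> states m V es (Suc i) j
      then (\<Sum>x\<in>states m V es i j. f x * dcoef m V es x t) else 0)"

definition cocycles :: "nat \<Rightarrow> 'v set \<Rightarrow> 'v set list \<Rightarrow> nat \<Rightarrow> int \<Rightarrow> ('v state \<Rightarrow> int) set" where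
  "cocycles m V es i j = kernel (cochain_group m V es i j) (cochain_group m V es (Suc i) j) (dmap m V es i j)"

definition coboundaries :: "nat \<Rightarrow> 'v set \<Rightarrow> 'v set list \<Rightarrow> nat \<Rightarrow> int \<Rightarrow> ('v state \<Rightarrow> int) set" where
  "coboundaries m V es i j = (case i of 0 \<Rightarrow> {\<lambda>x. 0}
      | Suc k \<Rightarrow> dmap m V es k j ` carrier (cochain_group m V es k j))"

text \<open>H^{i,j}_{A_m}(G).\<close>
definition cohomology :: "nat \<Rightarrow> 'v set \<Rightarrow> 'v set list \<Rightarrow> nat \<Rightarrow> int \<Rightarrow> ('v state \<Rightarrow> int) set monoid" where
  "cohomology m V es i j =
     (cochain_group m V es i j)\<lparr>carrier := cocycles m V es i j\<rparr> Mod coboundaries m V es i j"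

text \<open>Graph invariants.\<close>
definition num_components :: "'v set \<Rightarrow> 'v set list \<Rightarrow> nat" where
  "num_components V es = card (comps V es {..<length es})"

definition bipartite_comp :: "'v set list \<Rightarrow> 'v set \<Rightarrow> bool" where
  "bipartite_comp es C \<longleftrightarrow> (\<exists>f :: 'v \<Rightarrow> bool. \<forall>e\<in>set es. e \<subseteq> C \<longrightarrow>
      (\<forall>a b. e = {a, b} \<longrightarrow> f a \<noteq> f b))"

definition num_bip_components :: "'v set \<Rightarrow> 'v set list \<Rightarrow> nat" where
  "num_bip_components V es = card {C \<in> comps V es {..<length es}. bipartite_comp es C}"

definition cyclomatic :: "'v set \<Rightarrow> 'v set list \<Rightarrow> int" where
  "cyclomatic V es = int (length es) - int (card V) + int (num_components V es)"

text \<open>Z^a (+) Z_2^b.\<close>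
definition Zfree_plus_Z2 :: "nat \<Rightarrow> nat \<Rightarrow> ((nat \<Rightarrow> int) \<times> (nat \<Rightarrow> int)) monoid" where
  "Zfree_plus_Z2 a b = product_group {..<a} (\<lambda>_. integer_group)
                       \<times>\<times> product_group {..<b} (\<lambda>_. integer_mod_group 2)"

end

theory Submission
  imports Defs
begin

text \<open>In degree \<open>v - 1\<close> a state on the empty edge set is a vertex (the one of weight 1), a state on
one edge is that edge, and there is no state on two edges because the graph has no parallel edges.
The differential becomes the unsigned incidence map \<open>f \<mapsto> (e \<mapsto> \<Sum>x\<in>e. f x)\<close> from
\<open>\<int>\<^sup>V\<close> to \<open>\<int>\<^sup>E\<close>. Properly 2-colour a spanning forest \<open>F\<close> by signs \<open>\<epsilon>\<close>:
the incidence map is onto \<open>\<int>\<^sup>F\<close>, and its kernel over \<open>F\<close> consists of the functions that are a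
constant multiple \<open>n\<close> of \<open>\<epsilon>\<close> on each component. The edges off \<open>F\<close> see such a function as
\<open>\<plusminus>2n\<close> if both ends have the same sign and as 0 otherwise, and the first kind of edge exists exactly
in the non-bipartite components. So a bipartite component contributes a free generator to the
kernel, and a non-bipartite one contributes twice a primitive vector to the image.\<close>

section \<open>Connectivity and spanning forests\<close>

lemma simple_graph_edge:
  assumes "simple_graph V es" "i < length es"
  obtains a b where "es ! i = {a, b}" "a \<noteq> b" "a \<in> V" "b \<in> V"
  using assms unfolding simple_graph_def
  by (metis card_2_iff insert_subset nth_mem)

lemma equiv_conn: "equiv V (conn V es s)"
proof -
  have "sym (adj es s)" by (auto simp: sym_def adj_def insert_commute)
  then have "sym ((adj es s)\<^sup>*)" by (rule sym_rtrancl)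
  then show ?thesis
    unfolding conn_def equiv_def refl_on_def sym_def trans_def
    by (auto intro: rtrancl_trans)
qed

lemma conn_refl: "a \<in> V \<Longrightarrow> (a, a) \<in> conn V es s"
  by (simp add: conn_def)

lemma conn_sym: "(a, b) \<in> conn V es s \<Longrightarrow> (b, a) \<in> conn V es s"
  using equiv_conn[of V es s] by (auto simp: equiv_def sym_def)

lemma conn_trans:
  "(a, b) \<in> conn V es s \<Longrightarrow> (b, c) \<in> conn V es s \<Longrightarrow> (a, c) \<in> conn V es s"
  using equiv_conn[of V es s] by (auto simp: equiv_def dest: transD)

lemma conn_in: "(a, b) \<in> conn V es s \<Longrightarrow> a \<in> V \<and> b \<in> V"
  by (simp add: conn_def)

lemma conn_empty: "conn V es {} = Id_on V"
  by (auto simp: conn_def adj_def)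

text \<open>A path can be shortened until it uses the new edge at most once, in one of its two
  directions.\<close>

lemma conn_insert:
  assumes "i < length es" "es ! i = {a, b}" "a \<in> V" "b \<in> V"
  shows "(x, y) \<in> conn V es (insert i s) \<longleftrightarrow>
    (x, y) \<in> conn V es s \<or> (x, a) \<in> conn V es s \<and> (b, y) \<in> conn V es s
      \<or> (x, b) \<in> conn V es s \<and> (a, y) \<in> conn V es s"
proof -
  have "adj es (insert i s) = insert (a, b) (insert (b, a) (adj es s))"
    using assms(1,2) by (auto simp: adj_def doubleton_eq_iff)
  moreover have "sym ((adj es s)\<^sup>*)"
    by (rule sym_rtrancl) (auto simp: sym_def adj_def insert_commute)
  ultimately show ?thesis
    using assms(3,4) unfolding conn_def
    by (auto simp: rtrancl_insert dest: symD intro: rtrancl_trans)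
qed

lemma conn_insert_joined:
  assumes "i < length es" "es ! i = {a, b}" "(a, b) \<in> conn V es s"
  shows "conn V es (insert i s) = conn V es s"
proof -
  have ab: "a \<in> V" "b \<in> V" using conn_in[OF assms(3)] by auto
  have "(x, y) \<in> conn V es (insert i s) \<longleftrightarrow> (x, y) \<in> conn V es s" for x y
    unfolding conn_insert[OF assms(1,2) ab] using assms(3) by (meson conn_trans conn_sym)
  then show ?thesis by auto
qed

lemma finite_comps: "finite V \<Longrightarrow> finite (comps V es s)"
  unfolding comps_def by (rule finite_quotient) (auto simp: conn_def)

text \<open>By \<open>conn_insert\<close>, only vertices that reach \<open>a\<close> or
  \<open>b\<close> get a larger class, and that class is the union of the two old ones.\<close>

lemma comps_insert:
  assumes "i < length es" "es ! i = {a, b}" "a \<in> V" "b \<in> V" "(a, b) \<notin> conn V es s"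
  shows "comps V es (insert i s) =
    insert (compo V es s a \<union> compo V es s b) (comps V es s - {compo V es s a, compo V es s b})"
proof -
  let ?R = "conn V es s" and ?R' = "conn V es (insert i s)"
  note ins = conn_insert[OF assms(1-4), of _ _ s]
  have ab: "?R' `` {x} = ?R `` {a} \<union> ?R `` {b}" if "(a, x) \<in> ?R \<or> (b, x) \<in> ?R" for x
  proof -
    have "(x, y) \<in> ?R' \<longleftrightarrow> (a, y) \<in> ?R \<or> (b, y) \<in> ?R" for y
      unfolding ins using that assms(3,4) by (meson conn_trans conn_sym conn_refl)
    then show ?thesis by auto
  qed
  have other: "?R' `` {x} = ?R `` {x}" if "(a, x) \<notin> ?R" "(b, x) \<notin> ?R" for x
    using that ins by (auto dest: conn_sym)
  have eq: "?R `` {x} = ?R `` {y} \<longleftrightarrow> (y, x) \<in> ?R" if "x \<in> V" "y \<in> V" for x y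
    using eq_equiv_class_iff[OF equiv_conn that] by (auto dest: conn_sym)
  show ?thesis (is "?L = ?M")
  proof (rule Set.set_eqI)
    fix C
    show "C \<in> ?L \<longleftrightarrow> C \<in> ?M"
    proof
      assume "C \<in> ?L"
      then obtain x where x: "x \<in> V" "C = ?R' `` {x}"
        by (auto simp: comps_def quotient_def)
      show "C \<in> ?M"
        using x ab[of x] other[of x] eq[OF x(1)] assms(3,4)
        unfolding compo_def comps_def quotient_def
        by (cases "(a, x) \<in> ?R \<or> (b, x) \<in> ?R") auto
    next
      assume "C \<in> ?M"
      then consider "C = ?R `` {a} \<union> ?R `` {b}"
        | x where "x \<in> V" "C = ?R `` {x}" "C \<noteq> ?R `` {a}" "C \<noteq> ?R `` {b}"
        by (auto simp: comps_def compo_def quotient_def)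
      then show "C \<in> ?L"
      proof cases
        case 1
        then have "C = ?R' `` {a}" using ab[of a] conn_refl[OF assms(3)] by simp
        then show ?thesis using assms(3) by (auto simp: comps_def quotient_def)
      next
        case 2
        then have "C = ?R' `` {x}" using other[of x] eq[OF 2(1)] assms(3,4) by auto
        then show ?thesis using 2(1) by (auto simp: comps_def quotient_def)
      qed
    qed
  qed
qed

lemma card_comps_insert:
  assumes "finite V" "i < length es" "es ! i = {a, b}" "a \<in> V" "b \<in> V" "(a, b) \<notin> conn V es s"
  shows "Suc (card (comps V es (insert i s))) = card (comps V es s)"
proof -
  let ?A = "compo V es s a" and ?B = "compo V es s b"
  have in_comps: "?A \<in> comps V es s" "?B \<in> comps V es s"
    using assms(4,5) by (auto simp: comps_def compo_def quotient_def)
  have self: "a \<in> ?A" "b \<in> ?B"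
    using assms(4,5) by (auto simp: compo_def conn_refl)
  have "b \<notin> ?A" "a \<notin> ?B" using assms(6) by (auto simp: compo_def dest: conn_sym)
  then have "?A \<noteq> ?B" using self by blast
  \<comment> \<open>Needed for the count: two classes leave, and the one that enters must not be
    present already. Classes are equal or disjoint, but the union meets \<open>?A\<close> and also
    contains \<open>b\<close>.\<close>
  have new: "?A \<union> ?B \<notin> comps V es s"
  proof
    assume "?A \<union> ?B \<in> comps V es s"
    then have "?A \<union> ?B = ?A \<or> (?A \<union> ?B) \<inter> ?A = {}"
      using in_comps(1) quotient_disj[OF equiv_conn] unfolding comps_def by metis
    then show False using self \<open>b \<notin> ?A\<close> by blast
  qed
  have fin: "finite (comps V es s)" by (rule finite_comps[OF assms(1)])
  have "card {?A, ?B} \<le> card (comps V es s)"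
    using in_comps fin by (intro card_mono) auto
  then show ?thesis
    using comps_insert[OF assms(2-6)] in_comps \<open>?A \<noteq> ?B\<close> new fin
    by (simp add: card_Diff_subset)
qed

lemma comps_empty: "comps V es {} = (\<lambda>a. {a}) ` V"
  by (auto simp: comps_def conn_empty quotient_def)

lemma card_comps_empty: "card (comps V es {}) = card V"
  by (simp add: comps_empty card_image)

section \<open>Spanning forests with a 2-colouring by signs\<close>

text \<open>Kruskal's induction over the edges: an edge enters \<open>F\<close> exactly when it
  joins two components of the edges treated so far. All five properties are carried along together,
  since surjectivity for the larger forest is derived from the description of the kernel for the
  smaller one.\<close>

lemma spanning_forest:
  assumes sg: "simple_graph V es" and s: "s \<subseteq> {..<length es}"
  obtains F and \<epsilon> :: "'v \<Rightarrow> int" where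
    "F \<subseteq> s" "card F + card (comps V es s) = card V" "\<And>x. \<epsilon> x = 1 \<or> \<epsilon> x = -1"
    "\<And>g::nat \<Rightarrow> int. \<exists>f. \<forall>i\<in>F. sum f (es ! i) = g i"
    "\<And>f. (\<forall>i\<in>F. sum f (es ! i) = 0) \<longleftrightarrow> (\<forall>x y. (x, y) \<in> conn V es s \<longrightarrow> f x * \<epsilon> x = f y * \<epsilon> y)"
proof -
  have finV: "finite V" using sg by (simp add: simple_graph_def)
  have "finite s" using s finite_subset by blast
  then have "\<exists>F \<epsilon>. F \<subseteq> s \<and> card F + card (comps V es s) = card V \<and> (\<forall>x. \<epsilon> x = 1 \<or> \<epsilon> x = (-1::int))
     \<and> (\<forall>g::nat \<Rightarrow> int. \<exists>f. \<forall>i\<in>F. sum f (es ! i) = g i)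
     \<and> (\<forall>f. (\<forall>i\<in>F. sum f (es ! i) = 0) \<longleftrightarrow> (\<forall>x y. (x, y) \<in> conn V es s \<longrightarrow> f x * \<epsilon> x = f y * \<epsilon> y))"
    using s
  proof (induction s rule: finite_induct)
    case empty
    show ?case
      by (rule exI[of _ "{}"], rule exI[of _ "\<lambda>_. 1"]) (auto simp: card_comps_empty conn_empty)
  next
    case (insert i s)
    then obtain F and \<epsilon> :: "'v \<Rightarrow> int" where IH: "F \<subseteq> s" "card F + card (comps V es s) = card V"
      "\<And>x. \<epsilon> x = 1 \<or> \<epsilon> x = (-1::int)"
      "\<And>g::nat \<Rightarrow> int. \<exists>f. \<forall>i\<in>F. sum f (es ! i) = g i"
      "\<And>f. (\<forall>i\<in>F. sum f (es ! i) = 0) \<longleftrightarrow> (\<forall>x y. (x, y) \<in> conn V es s \<longrightarrow> f x * \<epsilon> x = f y * \<epsilon> y)"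
      by auto
    have i: "i < length es" using insert.prems by simp
    obtain a b where ab: "es ! i = {a, b}" "a \<noteq> b" "a \<in> V" "b \<in> V"
      using simple_graph_edge[OF sg i] .
    have sum_i: "sum f (es ! i) = f a + f b" for f :: "'v \<Rightarrow> int" using ab by simp
    show ?case
    proof (cases "(a, b) \<in> conn V es s")
      case True
      have "conn V es (insert i s) = conn V es s" by (rule conn_insert_joined[OF i ab(1) True])
      then show ?thesis using IH by (intro exI[of _ F] exI[of _ \<epsilon>]) (auto simp: comps_def)
    next
      case False
      \<comment> \<open>The factor \<open>- \<epsilon> a * \<epsilon> b\<close> is -1 if
        \<open>a\<close> and \<open>b\<close> have equal signs and 1 otherwise. So the component of
        \<open>b\<close> is flipped only if this is needed to give the new edge ends of opposite
        signs. The factor is constant on old components, so being balanced there keeps its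
        meaning.\<close>
      define \<epsilon>' where "\<epsilon>' x = (if (b, x) \<in> conn V es s then - \<epsilon> a * \<epsilon> b * \<epsilon> x else \<epsilon> x)" for x
      have sq: "\<epsilon> x * \<epsilon> x = 1" for x using IH(3)[of x] by auto
      have sign: "\<epsilon>' x = 1 \<or> \<epsilon>' x = -1" for x
        using IH(3)[of x] IH(3)[of a] IH(3)[of b] by (auto simp: \<epsilon>'_def)
      have \<epsilon>'_ab: "\<epsilon>' a = \<epsilon> a" "\<epsilon>' b = - \<epsilon> a"
        using False sq[of b] ab by (auto simp: \<epsilon>'_def conn_refl dest: conn_sym)
      have same: "f x * \<epsilon>' x = f y * \<epsilon>' y \<longleftrightarrow> f x * \<epsilon> x = f y * \<epsilon> y" if "(x, y) \<in> conn V es s" for f x y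
      proof -
        have "(b, x) \<in> conn V es s \<longleftrightarrow> (b, y) \<in> conn V es s"
          using that by (blast intro: conn_trans conn_sym)
        then show ?thesis
          using IH(3)[of a] IH(3)[of b] by (auto simp: \<epsilon>'_def)
      qed
      have "i \<notin> F" "finite F" using IH(1) insert.hyps finite_subset by auto
      have cardF: "card (insert i F) + card (comps V es (insert i s)) = card V"
        using card_comps_insert[OF finV i ab(1,3,4) False] IH(2) \<open>i \<notin> F\<close> \<open>finite F\<close> by simp
      have onto: "\<exists>f. \<forall>k\<in>insert i F. sum f (es ! k) = g k" for g :: "nat \<Rightarrow> int"
      proof -
        obtain f where f: "\<forall>k\<in>F. sum f (es ! k) = g k" using IH(4) by blast
        \<comment> \<open>The correction lives on the component of \<open>b\<close> and has at
          \<open>b\<close> the value still missing on edge \<open>i\<close>. The signs make it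
          balanced, hence null on \<open>F\<close>, so the values already reached there
          survive.\<close>
        define h where "h x = (if (b, x) \<in> conn V es s then \<epsilon> x * \<epsilon> b * (g i - f a - f b) else 0)" for x
        have "h x * \<epsilon> x = h y * \<epsilon> y" if "(x, y) \<in> conn V es s" for x y
        proof -
          have "(b, x) \<in> conn V es s \<longleftrightarrow> (b, y) \<in> conn V es s"
            using that by (blast intro: conn_trans conn_sym)
          then show ?thesis using sq[of x] sq[of y] by (simp add: h_def)
        qed
        then have "\<forall>k\<in>F. sum h (es ! k) = 0" using IH(5) by blast
        moreover have "h a = 0" "h b = g i - f a - f b"
          using False sq[of b] ab by (auto simp: h_def conn_refl dest: conn_sym)
        ultimately have "\<forall>k\<in>insert i F. sum (\<lambda>x. f x + h x) (es ! k) = g k"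
          using f by (simp add: sum.distrib sum_i)
        then show ?thesis by blast
      qed
      have ker: "(\<forall>k\<in>insert i F. sum f (es ! k) = 0) \<longleftrightarrow>
        (\<forall>x y. (x, y) \<in> conn V es (insert i s) \<longrightarrow> f x * \<epsilon>' x = f y * \<epsilon>' y)" (is "?L \<longleftrightarrow> ?R") for f
      proof -
        have "f a + f b = 0 \<longleftrightarrow> f a * \<epsilon>' a = f b * \<epsilon>' b"
          using IH(3)[of a] by (auto simp: \<epsilon>'_ab)
        then have "?L \<longleftrightarrow> f a * \<epsilon>' a = f b * \<epsilon>' b \<and>
          (\<forall>x y. (x, y) \<in> conn V es s \<longrightarrow> f x * \<epsilon>' x = f y * \<epsilon>' y)"
          using IH(5)[of f] same by (auto simp: sum_i)
        also have "\<dots> \<longleftrightarrow> ?R"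
        proof
          assume "f a * \<epsilon>' a = f b * \<epsilon>' b \<and> (\<forall>x y. (x, y) \<in> conn V es s \<longrightarrow> f x * \<epsilon>' x = f y * \<epsilon>' y)"
          then show ?R unfolding conn_insert[OF i ab(1,3,4)] by metis
        next
          assume ?R
          then show "f a * \<epsilon>' a = f b * \<epsilon>' b \<and> (\<forall>x y. (x, y) \<in> conn V es s \<longrightarrow> f x * \<epsilon>' x = f y * \<epsilon>' y)"
            unfolding conn_insert[OF i ab(1,3,4)] using conn_refl[OF ab(3)] conn_refl[OF ab(4)] by blast
        qed
        finally show ?thesis .
      qed
      show ?thesis
        using IH(1) cardF sign onto ker by (intro exI[of _ "insert i F"] exI[of _ \<epsilon>']) blast
    qed
  qed
  then show thesis using that by blast
qed

section \<open>The unsigned incidence map\<close>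

lemma bij_betw_lessThan_card:
  assumes "finite A"
  obtains h where "bij_betw h {..<card A} A"
  using ex_bij_betw_nat_finite[OF assms] by (metis atLeast0LessThan)

text \<open>The output of \<open>spanning_forest\<close> for the set of all edges. The forest is
  recorded through its consequences: its size, surjectivity onto \<int>^F and the kernel over
  \<open>F\<close>. A function with \<open>f x * \<epsilon> x\<close> constant on components is
  called balanced below.\<close>

locale signed_forest =
  fixes V :: "'v set" and es :: "'v set list" and F :: "nat set" and \<epsilon> :: "'v \<Rightarrow> int"
  assumes graph: "simple_graph V es"
    and F_sub: "F \<subseteq> {..<length es}"
    and card_F: "card F + num_components V es = card V"
    and sign: "\<epsilon> x = 1 \<or> \<epsilon> x = -1"
    and onto: "\<exists>f. \<forall>i\<in>F. sum f (es ! i) = (g i :: int)"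
    and kernel_F: "(\<forall>i\<in>F. sum f (es ! i) = 0) \<longleftrightarrow>
      (\<forall>x y. (x, y) \<in> conn V es {..<length es} \<longrightarrow> f x * \<epsilon> x = f y * \<epsilon> y)"

lemma signed_forest_exists:
  assumes "simple_graph V es"
  obtains F \<epsilon> where "signed_forest V es F \<epsilon>"
proof (rule spanning_forest[OF assms order_refl])
  fix F and \<epsilon> :: "'a \<Rightarrow> int"
  assume F: "F \<subseteq> {..<length es}" "card F + card (comps V es {..<length es}) = card V"
    "\<And>x. \<epsilon> x = 1 \<or> \<epsilon> x = -1" "\<And>g::nat \<Rightarrow> int. \<exists>f. \<forall>i\<in>F. sum f (es ! i) = g i"
    "\<And>f. (\<forall>i\<in>F. sum f (es ! i) = 0) \<longleftrightarrow>
      (\<forall>x y. (x, y) \<in> conn V es {..<length es} \<longrightarrow> f x * \<epsilon> x = f y * \<epsilon> y)"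
  show thesis
    by (rule that[of F \<epsilon>], unfold_locales) (use assms F in \<open>simp_all only: num_components_def\<close>)
qed

section \<open>Signs of edges and the components that contain them\<close>

context signed_forest
begin

abbreviation "R \<equiv> conn V es {..<length es}"
abbreviation "\<C> \<equiv> comps V es {..<length es}"

text \<open>The common sign of the two ends of edge \<open>i\<close>, or 0 if they have opposite signs.\<close>
definition \<sigma> :: "nat \<Rightarrow> int" where "\<sigma> i = sum \<epsilon> (es ! i) div 2"

text \<open>The component containing edge \<open>i\<close>; taking the image of both ends avoids
  choosing one of them.\<close>

definition K :: "nat \<Rightarrow> 'v set" where "K i = R `` (es ! i)"

definition odd_comps :: "'v set set" where
  "odd_comps = {C \<in> \<C>. \<not> bipartite_comp es C}"

lemma finV: "finite V"
  using graph by (simp add: simple_graph_def)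

lemma eps_sq: "\<epsilon> x * \<epsilon> x = 1"
  using sign[of x] by auto

lemma edge_conn: "i < length es \<Longrightarrow> es ! i = {a, b} \<Longrightarrow> (a, b) \<in> R"
proof -
  assume i: "i < length es" and ab: "es ! i = {a, b}"
  then have "{a, b} \<subseteq> V" using graph nth_mem[OF i] by (auto simp: simple_graph_def)
  moreover have "(a, b) \<in> adj es {..<length es}" using i ab by (auto simp: adj_def)
  ultimately show ?thesis by (auto simp: conn_def)
qed

lemma K_eq:
  assumes "i < length es" "x \<in> es ! i"
  shows "K i = R `` {x}"
proof -
  obtain a b where ab: "es ! i = {a, b}" using simple_graph_edge[OF graph assms(1)] .
  have "R `` {a} = R `` {b}"
    by (rule equiv_class_eq[OF equiv_conn edge_conn[OF assms(1) ab]])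
  then show ?thesis using ab assms(2) by (auto simp: K_def)
qed

lemma edge_vertex:
  assumes "i < length es"
  obtains x where "x \<in> es ! i" "x \<in> V"
  using simple_graph_edge[OF graph assms] that by blast

lemma K_in: "i < length es \<Longrightarrow> K i \<in> \<C>"
proof -
  assume i: "i < length es"
  obtain x where "x \<in> es ! i" "x \<in> V" using edge_vertex[OF i] .
  then show ?thesis using K_eq[OF i] by (auto simp: comps_def intro: quotientI)
qed

lemma edge_sub_K: "i < length es \<Longrightarrow> es ! i \<subseteq> K i"
proof
  fix x assume x: "i < length es" "x \<in> es ! i"
  then have "x \<in> V" using graph nth_mem by (fastforce simp: simple_graph_def)
  then show "x \<in> K i" using K_eq[OF x] by (simp add: conn_refl)
qed

lemma comp_eq: "C \<in> \<C> \<Longrightarrow> x \<in> C \<Longrightarrow> C = R `` {x}"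
  unfolding comps_def by (auto simp: quotient_def intro: conn_trans conn_sym)

lemma comp_sub: "C \<in> \<C> \<Longrightarrow> C \<subseteq> V"
  unfolding comps_def by (auto simp: quotient_def dest: conn_in)

lemma edge_in_comp_iff:
  assumes "i < length es" "C \<in> \<C>" "x \<in> es ! i"
  shows "x \<in> C \<longleftrightarrow> C = K i"
  using K_eq[OF assms(1,3)] comp_eq[OF assms(2)] edge_sub_K[OF assms(1)] assms(3) by auto

lemma edge_sub_iff: "i < length es \<Longrightarrow> C \<in> \<C> \<Longrightarrow> es ! i \<subseteq> C \<longleftrightarrow> C = K i"
proof -
  assume i: "i < length es" and C: "C \<in> \<C>"
  obtain x where "x \<in> es ! i" using edge_vertex[OF i] .
  then show ?thesis using edge_in_comp_iff[OF i C] edge_sub_K[OF i] by blast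
qed

lemma sum_eps: "i < length es \<Longrightarrow> sum \<epsilon> (es ! i) = 2 * \<sigma> i \<and> (\<sigma> i = 0 \<or> \<sigma> i = 1 \<or> \<sigma> i = -1)"
proof -
  assume "i < length es"
  then obtain a b where "es ! i = {a, b}" "a \<noteq> b" using simple_graph_edge[OF graph] by metis
  then show ?thesis using sign[of a] sign[of b] by (auto simp: \<sigma>_def)
qed

text \<open>On the component of \<open>x\<close> a balanced function is the constant
  \<open>f x * \<epsilon> x\<close> times \<open>\<epsilon>\<close>, and the signs of the two ends
  add up to \<open>2 * \<sigma> i\<close>. This factor 2 is the source of the 2-torsion.\<close>

lemma sum_balanced:
  assumes "\<And>x y. (x, y) \<in> R \<Longrightarrow> f x * \<epsilon> x = f y * \<epsilon> y" and i: "i < length es" and x: "x \<in> es ! i"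
  shows "sum f (es ! i) = 2 * \<sigma> i * (f x * \<epsilon> x)"
proof -
  have "f y = f x * \<epsilon> x * \<epsilon> y" if "y \<in> es ! i" for y
  proof -
    have "(x, y) \<in> R"
      using K_eq[OF i x] edge_sub_K[OF i] that by auto
    then have "f x * \<epsilon> x = f y * \<epsilon> y" by (rule assms(1))
    then show ?thesis by (simp add: mult.assoc eps_sq)
  qed
  then have "sum f (es ! i) = (\<Sum>y\<in>es ! i. f x * \<epsilon> x * \<epsilon> y)" by (rule sum.cong[OF refl])
  also have "\<dots> = f x * \<epsilon> x * sum \<epsilon> (es ! i)" by (rule sum_distrib_left[symmetric])
  finally show ?thesis by (simp add: conjunct1[OF sum_eps[OF i]])
qed

text \<open>The sign function is itself balanced, with constant 1, so it lies in the kernel over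
  \<open>F\<close>.\<close>

lemma sigma_F: "i \<in> F \<Longrightarrow> \<sigma> i = 0"
proof -
  have "\<forall>i\<in>F. sum \<epsilon> (es ! i) = 0" unfolding kernel_F by (simp add: eps_sq)
  then show "i \<in> F \<Longrightarrow> \<sigma> i = 0" by (simp add: \<sigma>_def)
qed

text \<open>A 2-colouring of \<open>C\<close>, written with values 1 and -1 and extended by 0, sums
  to 0 on every edge of the graph. It is therefore balanced, and being nonzero on \<open>C\<close>
  it forces \<sigma> to vanish there by \<open>sum_balanced\<close>. Conversely, if \<sigma>
  vanishes on \<open>C\<close>, then \<epsilon> is a proper colouring.\<close>

lemma bipartite_iff:
  assumes C: "C \<in> \<C>"
  shows "bipartite_comp es C \<longleftrightarrow> (\<forall>i<length es. K i = C \<longrightarrow> \<sigma> i = 0)"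
proof
  assume "bipartite_comp es C"
  then obtain f :: "'v \<Rightarrow> bool" where
    f: "\<forall>e\<in>set es. e \<subseteq> C \<longrightarrow> (\<forall>a b. e = {a, b} \<longrightarrow> f a \<noteq> f b)"
    unfolding bipartite_comp_def ..
  define g :: "'v \<Rightarrow> int" where "g x = (if x \<in> C then if f x then 1 else -1 else 0)" for x
  have null: "sum g (es ! i) = 0" if i: "i < length es" for i
  proof -
    obtain a b where ab: "es ! i = {a, b}" "a \<noteq> b" using simple_graph_edge[OF graph i] .
    show ?thesis
    proof (cases "C = K i")
      case True
      then have "es ! i \<subseteq> C" using edge_sub_K[OF i] by simp
      moreover have "f a \<noteq> f b" using f[rule_format, OF nth_mem[OF i] calculation ab(1)] .
      ultimately show ?thesis using ab by (auto simp: g_def)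
    next
      case False
      then have "a \<notin> C" "b \<notin> C"
        using edge_in_comp_iff[OF i C, of a] edge_in_comp_iff[OF i C, of b] ab(1) by simp_all
      then show ?thesis using ab by (simp add: g_def)
    qed
  qed
  have bal: "g x * \<epsilon> x = g y * \<epsilon> y" if "(x, y) \<in> R" for x y
    using iffD1[OF kernel_F[of g]] null F_sub that by blast
  show "\<forall>i<length es. K i = C \<longrightarrow> \<sigma> i = 0"
  proof (intro allI impI)
    fix i assume i: "i < length es" "K i = C"
    obtain x where x: "x \<in> es ! i" using edge_vertex[OF i(1)] .
    then have "g x * \<epsilon> x \<noteq> 0"
      using edge_sub_K[OF i(1)] i(2) sign[of x] by (auto simp: g_def)
    then show "\<sigma> i = 0"
      using sum_balanced[OF bal i(1) x] null[OF i(1)] by simp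
  qed
next
  assume even: "\<forall>i<length es. K i = C \<longrightarrow> \<sigma> i = 0"
  show "bipartite_comp es C"
    unfolding bipartite_comp_def
  proof (intro exI[of _ "\<lambda>x. \<epsilon> x = 1"] ballI impI allI)
    fix e a b assume e: "e \<in> set es" "e \<subseteq> C" "e = {a, b}"
    obtain i where i: "i < length es" "es ! i = e" using e(1) by (auto simp: in_set_conv_nth)
    have "card e = 2" using graph e(1) by (simp add: simple_graph_def)
    then have "a \<noteq> b" using e(3) by auto
    have "C = K i" using e(2) unfolding i(2)[symmetric] edge_sub_iff[OF i(1) C] .
    then have "\<sigma> i = 0" using even i(1) by blast
    then have "sum \<epsilon> (es ! i) = 0" using sum_eps[OF i(1)] by simp
    then have "\<epsilon> a + \<epsilon> b = 0" using i(2) e(3) \<open>a \<noteq> b\<close> by simp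
    then show "(\<epsilon> a = 1) \<noteq> (\<epsilon> b = 1)" using sign[of a] sign[of b] by auto
  qed
qed

section \<open>The kernel of the incidence map\<close>

text \<open>The forest edges force balance. A non-bipartite component has an edge with nonzero
  \<sigma>, where the sum is plus or minus twice the constant, so the constant is 0; the edges of
  bipartite components add no condition.\<close>

lemma kernel_iff:
  "(\<forall>i<length es. sum f (es ! i) = 0) \<longleftrightarrow>
    (\<forall>x y. (x, y) \<in> R \<longrightarrow> f x * \<epsilon> x = f y * \<epsilon> y) \<and> (\<forall>C\<in>odd_comps. \<forall>x\<in>C. f x = 0)"
  (is "?L \<longleftrightarrow> ?bal \<and> ?van")
proof
  assume L: ?L
  then have bal: ?bal using kernel_F[of f] F_sub by blast
  have "f x = 0" if C: "C \<in> odd_comps" "x \<in> C" for C x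
  proof -
    obtain i where i: "i < length es" "K i = C" "\<sigma> i \<noteq> 0"
      using bipartite_iff[of C] C by (auto simp: odd_comps_def)
    obtain y where y: "y \<in> es ! i" using edge_vertex[OF i(1)] .
    have "sum f (es ! i) = 2 * \<sigma> i * (f y * \<epsilon> y)"
      by (rule sum_balanced[OF _ i(1) y]) (use bal in blast)
    then have "f y * \<epsilon> y = 0" using L i by simp
    moreover have "(y, x) \<in> R" using K_eq[OF i(1) y] i(2) C(2) by auto
    ultimately have "f x * \<epsilon> x = 0" using bal by metis
    then show ?thesis using sign[of x] by auto
  qed
  then show "?bal \<and> ?van" using bal by blast
next
  assume R: "?bal \<and> ?van"
  show ?L
  proof (intro allI impI)
    fix i assume i: "i < length es"
    obtain x where x: "x \<in> es ! i" using edge_vertex[OF i] .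
    have "\<sigma> i = 0 \<or> f x = 0"
      using R bipartite_iff[OF K_in[OF i]] K_in[OF i] i edge_sub_K[OF i] x
      by (auto simp: odd_comps_def)
    moreover have "sum f (es ! i) = 2 * \<sigma> i * (f x * \<epsilon> x)"
      by (rule sum_balanced[OF _ i x]) (use R in blast)
    ultimately show "sum f (es ! i) = 0" by auto
  qed
qed

lemma comp_vertex:
  assumes "C \<in> \<C>"
  shows "(SOME x. x \<in> C) \<in> C"
  using in_quotient_imp_non_empty[OF equiv_conn] assms by (metis comps_def some_in_eq)

text \<open>Evaluation at one representative \<open>r k\<close> per bipartite component identifies
  the kernel with a free group: the second property is surjectivity, the third injectivity.\<close>

lemma kernel_coordinates:
  obtains r where "\<And>k. k < num_bip_components V es \<Longrightarrow> r k \<in> V"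
    "\<And>z::nat \<Rightarrow> int. \<exists>f. (\<forall>i<length es. sum f (es ! i) = 0) \<and> (\<forall>k<num_bip_components V es. f (r k) = z k)"
    "\<And>(f::'v \<Rightarrow> int) x. \<lbrakk>\<And>i. i < length es \<Longrightarrow> sum f (es ! i) = 0; \<And>k. k < num_bip_components V es \<Longrightarrow> f (r k) = 0; x \<in> V\<rbrakk>
      \<Longrightarrow> f x = 0"
proof -
  let ?B = "{C \<in> \<C>. bipartite_comp es C}"
  have "finite ?B" using finite_comps[OF finV] by simp
  then obtain h where h: "bij_betw h {..<num_bip_components V es} ?B"
    using bij_betw_lessThan_card unfolding num_bip_components_def by blast
  define r where "r k = (SOME x. x \<in> h k)" for k
  have hk: "h k \<in> ?B" "r k \<in> h k" if "k < num_bip_components V es" for k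
    using bij_betwE[OF h] that comp_vertex by (auto simp: r_def)
  show thesis
  proof
    show "r k \<in> V" if "k < num_bip_components V es" for k
      using hk[OF that] comp_sub by blast
  next
    fix z :: "nat \<Rightarrow> int"
    let ?idx = "\<lambda>C. the_inv_into {..<num_bip_components V es} h C"
    \<comment> \<open>The balanced function through the prescribed values: the sign at the
      representative normalises it so that \<open>f (r k) = z k\<close>.\<close>
    define f where "f x = (if R `` {x} \<in> ?B
      then z (?idx (R `` {x})) * \<epsilon> (r (?idx (R `` {x}))) * \<epsilon> x else 0)" for x
    have bal: "f x * \<epsilon> x = f y * \<epsilon> y" if "(x, y) \<in> R" for x y
      using equiv_class_eq[OF equiv_conn that] by (simp add: f_def mult.assoc eps_sq)
    have van: "f x = 0" if "C \<in> odd_comps" "x \<in> C" for C x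
      using that comp_eq[of C x] by (auto simp: f_def odd_comps_def)
    have val: "f (r k) = z k" if k: "k < num_bip_components V es" for k
    proof -
      have "h k = R `` {r k}" using comp_eq hk[OF k] by blast
      moreover have "?idx (h k) = k"
        using the_inv_into_f_f[OF bij_betw_imp_inj_on[OF h]] k by simp
      ultimately have "f (r k) = z k * \<epsilon> (r k) * \<epsilon> (r k)"
        using hk(1)[OF k] unfolding f_def by argo
      then show ?thesis by (simp add: mult.assoc eps_sq)
    qed
    have "\<forall>i<length es. sum f (es ! i) = 0"
      unfolding kernel_iff by (intro conjI allI impI ballI; (rule bal van; assumption))
    then show "\<exists>f. (\<forall>i<length es. sum f (es ! i) = 0) \<and> (\<forall>k<num_bip_components V es. f (r k) = z k)"
      using val by (intro exI[of _ f]) simp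
  next
    fix f :: "'v \<Rightarrow> int" and x
    assume null: "\<And>i. i < length es \<Longrightarrow> sum f (es ! i) = 0"
      and zero: "\<And>k. k < num_bip_components V es \<Longrightarrow> f (r k) = 0" and x: "x \<in> V"
    have "(\<forall>x y. (x, y) \<in> R \<longrightarrow> f x * \<epsilon> x = f y * \<epsilon> y) \<and> (\<forall>C\<in>odd_comps. \<forall>x\<in>C. f x = 0)"
      using null by (subst kernel_iff[symmetric]) simp
    then have ker: "\<And>x y. (x, y) \<in> R \<Longrightarrow> f x * \<epsilon> x = f y * \<epsilon> y"
      "\<And>C x. C \<in> odd_comps \<Longrightarrow> x \<in> C \<Longrightarrow> f x = 0" by blast+
    let ?C = "R `` {x}"
    have C: "?C \<in> \<C>" "x \<in> ?C" using x by (auto simp: comps_def quotientI conn_refl)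
    show "f x = 0"
    proof (cases "bipartite_comp es ?C")
      case True
      then have "?C \<in> h ` {..<num_bip_components V es}"
        using C(1) unfolding bij_betw_imp_surj_on[OF h] by simp
      then obtain k where k: "k < num_bip_components V es" "?C = h k" by auto
      have "(x, r k) \<in> R" using hk(2)[OF k(1)] unfolding k(2)[symmetric] by simp
      then have "f x * \<epsilon> x = f (r k) * \<epsilon> (r k)" by (rule ker(1))
      then have "f x * \<epsilon> x = 0" using zero[OF k(1)] by simp
      then show ?thesis using sign[of x] by auto
    next
      case False
      then have "?C \<in> odd_comps" using C(1) by (simp add: odd_comps_def)
      then show ?thesis using C(2) by (rule ker(2))
    qed
  qed
qed

section \<open>The cokernel of the incidence map\<close>

text \<open>Together \<phi> and \<psi> modulo 2 induce an isomorphism of the cokernel with \<int>^d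
  plus t copies of \<int>/2: they are additive, jointly onto, and their common kernel is the image.
  Here \<psi> is kept integer valued and only its parity matters.\<close>

lemma cokernel_coordinates:
  fixes d t
  defines "d \<equiv> nat (cyclomatic V es - (int (num_components V es) - int (num_bip_components V es)))"
    and "t \<equiv> num_components V es - num_bip_components V es"
  obtains \<phi> \<psi> :: "(nat \<Rightarrow> int) \<Rightarrow> nat \<Rightarrow> int" where
    "\<And>g g' k. \<phi> (\<lambda>i. g i + g' i) k = \<phi> g k + \<phi> g' k"
    "\<And>g g' k. \<psi> (\<lambda>i. g i + g' i) k = \<psi> g k + \<psi> g' k"
    "\<And>y z. \<exists>g. (\<forall>k<d. \<phi> g k = y k) \<and> (\<forall>k<t. \<psi> g k = z k)"
    "\<And>g. (\<forall>k<d. \<phi> g k = 0) \<and> (\<forall>k<t. even (\<psi> g k)) \<longleftrightarrow> (\<exists>f. \<forall>i<length es. g i = sum f (es ! i))"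
proof -
  \<comment> \<open>\<open>w C\<close> is one chosen edge of \<open>C\<close> whose ends have equal signs. After subtracting a solution
    on \<open>F\<close>, the value at \<open>w C\<close> matters modulo 2 (this is \<open>\<psi>\<close>); the values on the remaining
    edges \<open>D\<close>, corrected by a multiple of the value at \<open>w C\<close>, are free (this is \<open>\<phi>\<close>).\<close>
  have "\<forall>C\<in>odd_comps. \<exists>i<length es. K i = C \<and> \<sigma> i \<noteq> 0"
    using bipartite_iff by (auto simp: odd_comps_def)
  then obtain w where w: "\<And>C. C \<in> odd_comps \<Longrightarrow> w C < length es"
    "\<And>C. C \<in> odd_comps \<Longrightarrow> K (w C) = C" "\<And>C. C \<in> odd_comps \<Longrightarrow> \<sigma> (w C) \<noteq> 0"
    by metis
  have w_sq: "\<sigma> (w C) * \<sigma> (w C) = 1" if "C \<in> odd_comps" for C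
    using sum_eps[OF w(1)[OF that]] w(3)[OF that] by auto
  have odd_iff: "K i \<in> odd_comps" if "i < length es" "\<sigma> i \<noteq> 0" for i
    using bipartite_iff[OF K_in[OF that(1)]] K_in[OF that(1)] that by (auto simp: odd_comps_def)
  define D where "D = {..<length es} - F - w ` odd_comps"
  have finC: "finite \<C>" by (rule finite_comps[OF finV])
  then have fin_odd: "finite odd_comps" by (simp add: odd_comps_def)
  have "inj_on w odd_comps" using w(2) by (metis inj_onI)
  then have card_w: "card (w ` odd_comps) = card odd_comps" by (rule card_image)
  have disj: "F \<inter> w ` odd_comps = {}" using sigma_F w(3) by auto
  have finF: "finite F" using F_sub finite_subset by blast
  have split: "{..<length es} = D \<union> (F \<union> w ` odd_comps)" using F_sub w(1) by (auto simp: D_def)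
  have "card {..<length es} = card D + (card F + card odd_comps)"
    unfolding split card_w[symmetric]
    using disj finF fin_odd by (subst card_Un_disjoint card_Un_disjoint; auto simp: D_def card_Un_disjoint)+
  moreover have "card \<C> = num_bip_components V es + card odd_comps"
  proof -
    have "\<C> = {C \<in> \<C>. bipartite_comp es C} \<union> odd_comps" by (auto simp: odd_comps_def)
    then show ?thesis
      using finC unfolding num_bip_components_def
      by (subst card_Un_disjoint[symmetric]) (auto simp: odd_comps_def)
  qed
  \<comment> \<open>The cyclomatic number is the number of edges outside \<open>F\<close>, and
    \<open>odd_comps\<close> has one distinguished edge each. The difference is thus a cardinality,
    and \<open>nat\<close> truncates nothing.\<close>
  ultimately have card_D: "card D = d" and card_odd: "card odd_comps = t"
    using card_F by (simp_all add: d_def t_def cyclomatic_def num_components_def)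
  have "finite D" by (simp add: D_def)
  then obtain p where p: "bij_betw p {..<d} D"
    using bij_betw_lessThan_card unfolding card_D[symmetric] by blast
  obtain q where q: "bij_betw q {..<t} odd_comps"
    using bij_betw_lessThan_card[OF fin_odd] unfolding card_odd[symmetric] by blast
  \<comment> \<open>Preimages are chosen for the indicators of single forest edges only and then
    combined linearly. This makes the solution \<open>s g\<close> additive in \<open>g\<close>,
    which a separate choice for each \<open>g\<close> would not.\<close>
  have "\<forall>j. \<exists>f. \<forall>i\<in>F. sum f (es ! i) = (if i = j then 1 else 0 :: int)"
    by (intro allI onto)
  then obtain u where u: "\<And>j i. i \<in> F \<Longrightarrow> sum (u j) (es ! i) = (if i = j then 1 else 0 :: int)"
    by (auto dest!: choice)
  define s where "s g x = (\<Sum>j\<in>F. g j * u j x)" for g x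
  define r where "r g i = g i - sum (s g) (es ! i)" for g i
  \<comment> \<open>In the image, \<open>r g\<close> is \<open>2 * \<sigma> i * c\<close> on a
    component with constant \<open>c\<close>. Since nonzero \<sigma> squares to 1, the subtracted
    term is then exactly \<open>r g (p k)\<close>. In a bipartite component \<open>w\<close> is
    unspecified, but there \<open>\<sigma> (p k)\<close> is 0 and removes the term.\<close>
  define \<phi> where "\<phi> g k = r g (p k) - \<sigma> (p k) * \<sigma> (w (K (p k))) * r g (w (K (p k)))" for g k
  define \<psi> where "\<psi> g k = r g (w (q k))" for g k
  have r_add: "r (\<lambda>i. g i + g' i) k = r g k + r g' k" for g g' k
    by (simp add: r_def s_def distrib_right sum.distrib)
  have sum_s: "sum (s g) (es ! i) = g i" if "i \<in> F" for g i
  proof -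
    have "sum (s g) (es ! i) = (\<Sum>j\<in>F. g j * sum (u j) (es ! i))"
      unfolding s_def by (subst sum.swap) (simp add: sum_distrib_left)
    also have "\<dots> = (\<Sum>j\<in>F. if i = j then g j else 0)"
      by (rule sum.cong[OF refl]) (simp add: u[OF that])
    also have "\<dots> = g i" using that finF by simp
    finally show ?thesis .
  qed
  have p_in: "p k \<in> D" "p k < length es" if "k < d" for k
    using bij_betwE[OF p] that by (auto simp: D_def)
  have q_in: "q k \<in> odd_comps" if "k < t" for k
    using bij_betwE[OF q] that by auto
  show thesis
  proof
    show "\<phi> (\<lambda>i. g i + g' i) k = \<phi> g k + \<phi> g' k" for g g' k
      by (simp add: \<phi>_def r_add algebra_simps)
    show "\<psi> (\<lambda>i. g i + g' i) k = \<psi> g k + \<psi> g' k" for g g' k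
      by (simp add: \<psi>_def r_add)
  next
    fix y z :: "nat \<Rightarrow> int"
    define y' where "y' i = y (the_inv_into {..<d} p i)" for i
    define z' where "z' C = z (the_inv_into {..<t} q C)" for C
    have y': "y' (p k) = y k" if "k < d" for k
      using the_inv_into_f_f[OF bij_betw_imp_inj_on[OF p]] that by (simp add: y'_def)
    have z': "z' (q k) = z k" if "k < t" for k
      using the_inv_into_f_f[OF bij_betw_imp_inj_on[OF q]] that by (simp add: z'_def)
    \<comment> \<open>Zero on \<open>F\<close> makes \<open>s g\<close> vanish, so
      \<open>r g = g\<close>. On the edges of \<open>D\<close> the term that \<phi> will subtract is
      added in advance.\<close>
    define g where "g i = (if i \<in> F then 0 else if i \<in> w ` odd_comps then z' (K i)
      else y' i + \<sigma> i * \<sigma> (w (K i)) * z' (K i))" for i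
    have "s g x = 0" for x by (simp add: s_def g_def)
    then have rg: "r g = g" by (simp add: r_def fun_eq_iff)
    have gw: "g (w C) = z' C" if "C \<in> odd_comps" for C
      using that w(2) disj by (auto simp: g_def)
    have "\<phi> g k = y k" if k: "k < d" for k
    proof -
      have "g (p k) = y k + \<sigma> (p k) * \<sigma> (w (K (p k))) * z' (K (p k))"
        using p_in(1)[OF k] y'[OF k] by (auto simp: g_def D_def)
      then show ?thesis
        using odd_iff[OF p_in(2)[OF k]] gw by (cases "\<sigma> (p k) = 0") (auto simp: \<phi>_def rg)
    qed
    moreover have "\<psi> g k = z k" if "k < t" for k
      using gw[OF q_in] z' that by (simp add: \<psi>_def rg)
    ultimately show "\<exists>g. (\<forall>k<d. \<phi> g k = y k) \<and> (\<forall>k<t. \<psi> g k = z k)" by blast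
  next
    fix g
    show "(\<forall>k<d. \<phi> g k = 0) \<and> (\<forall>k<t. even (\<psi> g k)) \<longleftrightarrow> (\<exists>f. \<forall>i<length es. g i = sum f (es ! i))"
      (is "?L \<longleftrightarrow> ?M")
    proof
      assume ?M
      then obtain f where f: "\<And>i. i < length es \<Longrightarrow> g i = sum f (es ! i)" by blast
      \<comment> \<open>Both \<open>f\<close> and \<open>s g\<close> have the sums \<open>g\<close>
        on \<open>F\<close>, so their difference is balanced, and its edge sums are
        \<open>r g\<close>.\<close>
      let ?h = "\<lambda>x. f x - s g x"
      have rh: "r g i = sum ?h (es ! i)" if "i < length es" for i
        using f[OF that] by (simp add: r_def sum_subtractf)
      have "sum ?h (es ! i) = 0" if "i \<in> F" for i
        using f[of i] F_sub that sum_s[OF that] by (auto simp: sum_subtractf)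
      then have bal: "?h x * \<epsilon> x = ?h y * \<epsilon> y" if "(x, y) \<in> R" for x y
        using kernel_F[of ?h] that by blast
      have "\<psi> g k mod 2 = 0" if "k < t" for k
      proof -
        have i: "w (q k) < length es" using w(1) q_in that by blast
        obtain x where "x \<in> es ! w (q k)" using edge_vertex[OF i] .
        then show ?thesis using sum_balanced[of ?h, OF bal i] rh[OF i] by (simp add: \<psi>_def)
      qed
      moreover have "\<phi> g k = 0" if k: "k < d" for k
      proof (cases "\<sigma> (p k) = 0")
        case True
        obtain x where "x \<in> es ! p k" using edge_vertex[OF p_in(2)[OF k]] .
        then show ?thesis
          using True sum_balanced[of ?h, OF bal p_in(2)[OF k]] rh[OF p_in(2)[OF k]] by (simp add: \<phi>_def)
      next
        case False
        let ?C = "K (p k)" and ?i = "p k"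
        have C: "?C \<in> odd_comps" by (rule odd_iff[OF p_in(2)[OF k] False])
        obtain x where x: "x \<in> es ! ?i" using edge_vertex[OF p_in(2)[OF k]] .
        obtain y where y: "y \<in> es ! w ?C" using edge_vertex[OF w(1)[OF C]] .
        have "R `` {x} = R `` {y}"
          using K_eq[OF p_in(2)[OF k] x] K_eq[OF w(1)[OF C] y] w(2)[OF C] by simp
        moreover have "y \<in> R `` {y}" using y edge_sub_K[OF w(1)[OF C]] K_eq[OF w(1)[OF C] y] by blast
        ultimately have xy: "?h x * \<epsilon> x = ?h y * \<epsilon> y" using bal by blast
        have rp: "r g ?i = 2 * \<sigma> ?i * (?h x * \<epsilon> x)"
          using sum_balanced[of ?h, OF bal p_in(2)[OF k] x] rh[OF p_in(2)[OF k]] by simp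
        have rw: "r g (w ?C) = 2 * \<sigma> (w ?C) * (?h y * \<epsilon> y)"
          using sum_balanced[of ?h, OF bal w(1)[OF C] y] rh[OF w(1)[OF C]] by simp
        have "\<phi> g k = 2 * \<sigma> ?i * (?h y * \<epsilon> y) * (1 - \<sigma> (w ?C) * \<sigma> (w ?C))"
          unfolding \<phi>_def rp rw xy by (simp add: algebra_simps)
        then show ?thesis by (simp add: w_sq[OF C])
      qed
      ultimately show ?L by blast
    next
      assume L: ?L
      \<comment> \<open>The constant is found by solving
        \<open>r g (w C) = 2 * \<sigma> (w C) * c C\<close>: evenness allows the halving, and
        \<open>\<sigma> (w C)\<close> is its own inverse. The default 0 serves bipartite components,
        where every edge sum of a balanced function is 0.\<close>
      define c where "c C = (if C \<in> odd_comps then r g (w C) div 2 * \<sigma> (w C) else 0)" for C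
      define h where "h x = c (R `` {x}) * \<epsilon> x" for x
      have bal: "h x * \<epsilon> x = h y * \<epsilon> y" if "(x, y) \<in> R" for x y
        using equiv_class_eq[OF equiv_conn that] by (simp add: h_def mult.assoc eps_sq)
      have sum_h: "sum h (es ! i) = 2 * \<sigma> i * c (K i)" if i: "i < length es" for i
      proof -
        obtain x where x: "x \<in> es ! i" using edge_vertex[OF i] .
        have "h x * \<epsilon> x = c (K i)" using K_eq[OF i x] by (simp add: h_def mult.assoc eps_sq)
        moreover have "sum h (es ! i) = 2 * \<sigma> i * (h x * \<epsilon> x)" by (rule sum_balanced[OF bal i x])
        ultimately show ?thesis by simp
      qed
      have even_w: "2 * (r g (w C) div 2) = r g (w C)" if "C \<in> odd_comps" for C
      proof -
        have "C \<in> q ` {..<t}" using that by (simp only: bij_betw_imp_surj_on[OF q])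
        then obtain k where k: "k < t" "q k = C" by auto
        have "even (\<psi> g k)" using conjunct2[OF L] k(1) by simp
        then show ?thesis unfolding \<psi>_def k(2) by (rule dvd_mult_div_cancel)
      qed
      have "r g i = sum h (es ! i)" if i: "i < length es" for i
      proof -
        consider "i \<in> F" | "i \<in> w ` odd_comps" | "i \<in> D" using split i by auto
        then show ?thesis
        proof cases
          case 1
          then show ?thesis using sigma_F sum_h[OF i] sum_s by (simp add: r_def)
        next
          case 2
          then obtain C where C: "C \<in> odd_comps" "i = w C" by blast
          have "sum h (es ! i) = (2 * (r g (w C) div 2)) * (\<sigma> (w C) * \<sigma> (w C))"
            unfolding sum_h[OF i] using C w(2) by (simp add: c_def)
          then show ?thesis using even_w w_sq C by simp
        next
          case 3
          then have "i \<in> p ` {..<d}" by (simp only: bij_betw_imp_surj_on[OF p])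
          then obtain k where k: "k < d" "p k = i" by auto
          have "\<phi> g k = 0" using conjunct1[OF L] k(1) by simp
          then have ri: "r g i = \<sigma> i * \<sigma> (w (K i)) * r g (w (K i))"
            by (simp add: \<phi>_def k(2))
          show ?thesis
          proof (cases "\<sigma> i = 0")
            case True
            then show ?thesis using ri sum_h[OF i] by simp
          next
            case False
            then have C: "K i \<in> odd_comps" by (rule odd_iff[OF i])
            have "sum h (es ! i) = \<sigma> i * \<sigma> (w (K i)) * (2 * (r g (w (K i)) div 2))"
              unfolding sum_h[OF i] using C by (simp add: c_def)
            then show ?thesis using ri even_w[OF C] by simp
          qed
        qed
      qed
      then have "g i = sum (\<lambda>x. h x + s g x) (es ! i)" if "i < length es" for i
        using that by (simp add: r_def sum.distrib diff_eq_eq)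
      then show ?M by blast
    qed
  qed
qed

end

section \<open>Cohomology in degree \<open>v - 1\<close>\<close>

text \<open>Every vertex carries x except \<open>a\<close>, which carries 1. Exponents are 0 off the
  components, as the canonical form in \<open>states\<close> demands.\<close>

definition vertex_state :: "'v set \<Rightarrow> 'v \<Rightarrow> 'v state" where
  "vertex_state V a = ({}, \<lambda>C. if C \<in> (\<lambda>b. {b}) ` (V - {a}) then 1 else 0)"

definition edge_state :: "'v set \<Rightarrow> 'v set list \<Rightarrow> nat \<Rightarrow> 'v state" where
  "edge_state V es i = ({i}, \<lambda>C. if C \<in> comps V es {i} then 1 else 0)"

lemma inj_vertex_state: "inj_on (vertex_state V) V"
proof (rule inj_onI)
  fix a b assume ab: "a \<in> V" "b \<in> V" "vertex_state V a = vertex_state V b"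
  then have "snd (vertex_state V a) {b} = snd (vertex_state V b) {b}" by simp
  then have "{b} \<notin> (\<lambda>b. {b}) ` (V - {a})" by (auto simp: vertex_state_def split: if_splits)
  then show "a = b" using ab(2) by blast
qed

lemma inj_edge_state: "inj (edge_state V es)"
  by (rule injI) (simp add: edge_state_def)

text \<open>The v exponents are at most 1 and add up to v-1, so exactly one of them is 0. If
  \<open>V\<close> is empty, the degree is -1 and both sides are empty.\<close>

lemma states_zero:
  assumes "finite V"
  shows "states 2 V es 0 (int (card V) - 1) = vertex_state V ` V"
proof (intro equalityI subsetI)
  fix x assume "x \<in> states 2 V es 0 (int (card V) - 1)"
  then obtain s c where x: "x = (s, c)" and s: "s \<subseteq> {..<length es}" "card s = 0"
    and c: "\<And>C. C \<in> comps V es s \<Longrightarrow> c C < 2" "\<And>C. C \<notin> comps V es s \<Longrightarrow> c C = 0"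
      "int (\<Sum>C\<in>comps V es s. c C) = int (card V) - 1"
    unfolding states_def by auto
  have "s = {}" using s finite_subset[OF s(1)] by simp
  have "inj_on (\<lambda>a. {a}) V" by simp
  then have "(\<Sum>C\<in>comps V es s. c C) = (\<Sum>a\<in>V. c {a})"
    unfolding \<open>s = {}\<close> comps_empty by (subst sum.reindex) simp_all
  moreover have le: "c {a} \<le> 1" if "a \<in> V" for a
    using c(1)[of "{a}"] that by (simp add: \<open>s = {}\<close> comps_empty)
  \<comment> \<open>The deficits \<open>1 - c {a}\<close> are counted: their total is 1, so a single
    vertex has deficit 1.\<close>
  then have "(\<Sum>a\<in>V. 1 - c {a}) + (\<Sum>a\<in>V. c {a}) = card V"
    unfolding sum.distrib[symmetric] card_eq_sum by (intro sum.cong) auto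
  ultimately have "(\<Sum>a\<in>V. 1 - c {a}) = Suc 0" using c(3) by linarith
  then obtain a where a: "a \<in> V" "1 - c {a} = Suc 0" "\<forall>b\<in>V. a \<noteq> b \<longrightarrow> 1 - c {b} = 0"
    unfolding sum_eq_Suc0_iff[OF assms] by blast
  have "c C = (if C \<in> (\<lambda>b. {b}) ` (V - {a}) then 1 else 0)" for C
  proof (cases "C \<in> comps V es s")
    case True
    then obtain b where b: "b \<in> V" "C = {b}" by (auto simp: \<open>s = {}\<close> comps_empty)
    then show ?thesis using a(2) a(3) le[of b] by (cases "a = b") (auto intro: le_antisym)
  next
    case False
    then show ?thesis using c(2) by (auto simp: \<open>s = {}\<close> comps_empty)
  qed
  then have "x = vertex_state V a" by (simp add: x \<open>s = {}\<close> vertex_state_def fun_eq_iff)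
  then show "x \<in> vertex_state V ` V" using a(1) by simp
next
  fix x assume "x \<in> vertex_state V ` V"
  then obtain a where a: "a \<in> V" "x = vertex_state V a" by blast
  let ?c = "\<lambda>C. if C \<in> (\<lambda>b. {b}) ` (V - {a}) then 1 else 0 :: nat"
  have "(\<Sum>C\<in>comps V es {}. ?c C) = (\<Sum>C\<in>(\<lambda>b. {b}) ` (V - {a}). 1)"
    unfolding comps_empty by (rule sum.mono_neutral_cong_right) (use assms in auto)
  also have "\<dots> = card V - 1" using a(1) by (simp add: card_image)
  finally have "(\<Sum>C\<in>comps V es {}. ?c C) = card V - 1" .
  moreover have "card V \<ge> 1" using a(1) assms by (simp add: Suc_le_eq card_gt_0_iff) blast
  ultimately have "int (\<Sum>C\<in>comps V es {}. ?c C) = int (card V) - 1" by (simp only: of_nat_diff of_nat_1)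
  then show "x \<in> states 2 V es 0 (int (card V) - 1)"
    unfolding a(2) vertex_state_def states_def by (auto simp: comps_empty)
qed

lemma card_comps_single:
  assumes "simple_graph V es" "i < length es"
  shows "Suc (card (comps V es {i})) = card V"
proof -
  obtain a b where ab: "es ! i = {a, b}" "a \<noteq> b" "a \<in> V" "b \<in> V"
    using simple_graph_edge[OF assms] .
  have "finite V" using assms(1) by (simp add: simple_graph_def)
  then show ?thesis
    using card_comps_insert[OF _ assms(2) ab(1,3,4), of "{}"] ab(2)
    by (simp add: conn_empty card_comps_empty Id_on_iff)
qed

text \<open>This is where the absence of parallel edges is used.\<close>
lemma card_comps_pair:
  assumes "simple_graph V es" "i < length es" "j < length es" "i \<noteq> j"
  shows "Suc (Suc (card (comps V es {i, j}))) = card V"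
proof -
  obtain a b where ab: "es ! i = {a, b}" "a \<noteq> b" "a \<in> V" "b \<in> V"
    using simple_graph_edge[OF assms(1,2)] .
  obtain x y where xy: "es ! j = {x, y}" "x \<noteq> y" "x \<in> V" "y \<in> V"
    using simple_graph_edge[OF assms(1,3)] .
  have fin: "finite V" and "distinct es" using assms(1) by (auto simp: simple_graph_def)
  then have "{a, b} \<noteq> {x, y}"
    using assms(2-4) nth_eq_iff_index_eq[of es i j] ab(1) xy(1) by simp
  then have "(x, y) \<notin> conn V es {i}"
    using xy(2) unfolding conn_insert[OF assms(2) ab(1,3,4)] by (auto simp: conn_empty)
  then have "Suc (card (comps V es (insert j {i}))) = card (comps V es {i})"
    by (rule card_comps_insert[OF fin assms(3) xy(1,3,4)])
  then show ?thesis using card_comps_single[OF assms(1,2)] by (simp add: insert_commute)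
qed

text \<open>One edge leaves v-1 components, so reaching degree v-1 with exponents at most 1 forces
  every exponent to be 1.\<close>

lemma states_one:
  assumes sg: "simple_graph V es"
  shows "states 2 V es 1 (int (card V) - 1) = edge_state V es ` {..<length es}"
proof (intro equalityI subsetI)
  have finV: "finite V" using sg by (simp add: simple_graph_def)
  fix x assume "x \<in> states 2 V es 1 (int (card V) - 1)"
  then obtain s c where x: "x = (s, c)" and s: "s \<subseteq> {..<length es}" "card s = 1"
    and c: "\<And>C. C \<in> comps V es s \<Longrightarrow> c C < 2" "\<And>C. C \<notin> comps V es s \<Longrightarrow> c C = 0"
      "int (\<Sum>C\<in>comps V es s. c C) = int (card V) - 1"
    unfolding states_def by auto
  obtain i where i: "s = {i}" using s(2) by (auto simp: card_1_singleton_iff)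
  then have "i < length es" using s(1) by simp
  have le: "c C \<le> 1" if "C \<in> comps V es s" for C using c(1)[OF that] by simp
  then have "(\<Sum>C\<in>comps V es s. 1 - c C) + (\<Sum>C\<in>comps V es s. c C) = card (comps V es s)"
    unfolding sum.distrib[symmetric] card_eq_sum by (intro sum.cong) auto
  then have "(\<Sum>C\<in>comps V es s. 1 - c C) = 0"
    using c(3) card_comps_single[OF sg \<open>i < length es\<close>] unfolding i by linarith
  then have one: "c C = 1" if "C \<in> comps V es s" for C
  proof -
    have "1 - c C = 0"
      using \<open>(\<Sum>C\<in>comps V es s. 1 - c C) = 0\<close> finite_comps[OF finV, of es s] that by simp
    then show ?thesis using le[OF that] by linarith
  qed
  have "x = edge_state V es i"
    unfolding x i edge_state_def using one c(2) by (auto simp: i fun_eq_iff)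
  then show "x \<in> edge_state V es ` {..<length es}" using \<open>i < length es\<close> by simp
next
  fix x assume "x \<in> edge_state V es ` {..<length es}"
  then obtain i where i: "i < length es" "x = edge_state V es i" by blast
  then have "int (card (comps V es {i})) = int (card V) - 1"
    using card_comps_single[OF sg i(1)] by linarith
  then show "x \<in> states 2 V es 1 (int (card V) - 1)"
    using i by (auto simp: states_def edge_state_def)
qed

text \<open>Two distinct edges leave v-2 components, which bounds the degree by v-2.\<close>

lemma states_two:
  assumes sg: "simple_graph V es"
  shows "states 2 V es 2 (int (card V) - 1) = {}"
proof (rule ccontr)
  assume "states 2 V es 2 (int (card V) - 1) \<noteq> {}"
  then obtain s c where s: "s \<subseteq> {..<length es}" "card s = 2"
    and c: "\<And>C. C \<in> comps V es s \<Longrightarrow> c C < 2"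
      "int (\<Sum>C\<in>comps V es s. c C) = int (card V) - 1"
    unfolding states_def by auto
  obtain i j where ij: "s = {i, j}" "i \<noteq> j" using s(2) by (auto simp: card_2_iff)
  have "(\<Sum>C\<in>comps V es s. c C) \<le> card (comps V es s)"
    unfolding card_eq_sum using c(1) by (intro sum_mono) force
  moreover have "Suc (Suc (card (comps V es s))) = card V"
    using card_comps_pair[OF sg, of i j] ij s(1) by simp
  ultimately show False using c(2) by linarith
qed

section \<open>The differential from vertices to edges\<close>

text \<open>If \<open>x\<close> is an end of the edge, the merged weight is 1 times x and every
  component then carries x. Otherwise the merged weight is the square of x, which is zero for m =
  2.\<close>

lemma d_edge_vertex_state:
  assumes sg: "simple_graph V es" and i: "i < length es" and x: "x \<in> V"
  shows "d_edge 2 V es i (vertex_state V x) = (if x \<in> es ! i then Some (edge_state V es i) else None)"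
proof -
  \<comment> \<open>These name the two choices made inside \<open>d_edge\<close>; they are the ends
    of the edge in some order.\<close>
  define a where "a = (SOME a. a \<in> es ! i)"
  define b where "b = (SOME b. b \<in> es ! i \<and> b \<noteq> a)"
  obtain a' b' where ab': "es ! i = {a', b'}" "a' \<noteq> b'" "a' \<in> V" "b' \<in> V"
    using simple_graph_edge[OF sg i] .
  then have "a' \<in> es ! i" by simp
  then have a: "a \<in> es ! i" unfolding a_def by (rule someI)
  have "\<exists>b. b \<in> es ! i \<and> b \<noteq> a" using ab'(1,2) by auto
  then have b: "b \<in> es ! i \<and> b \<noteq> a" unfolding b_def by (rule someI_ex)
  then have ab: "es ! i = {a, b}" "a \<noteq> b" "a \<in> V" "b \<in> V" using a ab' by auto
  have single: "compo V es {} y = {y}" if "y \<in> V" for y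
    using that by (auto simp: compo_def conn_empty)
  define c :: "'a set \<Rightarrow> nat" where "c = (\<lambda>C. if C \<in> (\<lambda>b. {b}) ` (V - {x}) then 1 else 0)"
  have ca: "c {a} = (if x = a then 0 else 1)" and cb: "c {b} = (if x = b then 0 else 1)"
    using ab by (auto simp: c_def)
  have state: "vertex_state V x = ({}, c)" by (simp add: vertex_state_def c_def)
  have "{a} \<noteq> {b}" using ab(2) by simp
  then have step: "d_edge 2 V es i (vertex_state V x) = (if c {a} + c {b} \<ge> 2 then None
     else Some ({i}, (c({a} := 0, {b} := 0))({a, b} := c {a} + c {b})))"
    unfolding d_edge_def state Let_def prod.case
      a_def[symmetric] b_def[symmetric] single[OF ab(3)] single[OF ab(4)]
    by (simp only: if_False insert_is_Un[of a "{b}"])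
  show ?thesis
  proof (cases "x \<in> es ! i")
    case False
    then have "c {a} + c {b} = 2" unfolding ca cb using ab(1) by simp
    then show ?thesis unfolding step using False by simp
  next
    case True
    have comps: "comps V es {i} = insert {a, b} ((\<lambda>a. {a}) ` V - {{a}, {b}})"
      using comps_insert[OF i ab(1,3,4), of "{}"] ab(2) single[OF ab(3)] single[OF ab(4)]
      by (simp add: conn_empty comps_empty insert_commute Id_on_iff)
    have sum1: "c {a} + c {b} = 1" unfolding ca cb using True ab by auto
    have "((c({a} := 0, {b} := 0))({a, b} := 1)) C = (if C \<in> comps V es {i} then 1 else 0)" for C
    proof (cases "C = {a, b} \<or> C = {a} \<or> C = {b}")
      case True
      then show ?thesis unfolding comps using ab(2) by (auto simp: doubleton_eq_iff)
    next
      case False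
      \<comment> \<open>The omitted vertex \<open>x\<close> is \<open>a\<close> or \<open>b\<close>,
        so away from the three updated sets the omission is invisible.\<close>
      then have "C \<in> (\<lambda>b. {b}) ` (V - {x}) \<longleftrightarrow> C \<in> (\<lambda>b. {b}) ` V"
        using True ab(1) by auto
      then show ?thesis unfolding comps using False by (simp add: c_def)
    qed
    then have upd: "(c({a} := 0, {b} := 0))({a, b} := 1) = (\<lambda>C. if C \<in> comps V es {i} then 1 else 0)"
      by (rule ext)
    show ?thesis unfolding step sum1 edge_state_def upd using True by simp
  qed
qed

text \<open>No edge precedes the added one, so all signs are +1 and the incidence map is unsigned.
  Only \<open>e = i\<close> contributes, because the target state determines its edge.\<close>

lemma dcoef_vertex_edge:
  assumes "simple_graph V es" "i < length es" "x \<in> V"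
  shows "dcoef 2 V es (vertex_state V x) (edge_state V es i) = (if x \<in> es ! i then 1 else 0)"
proof -
  have fst: "fst (vertex_state V x) = {}" by (simp add: vertex_state_def)
  have sign: "dsign {} = (\<lambda>e. 1)" by (simp add: dsign_def fun_eq_iff)
  have "dcoef 2 V es (vertex_state V x) (edge_state V es i) =
    (\<Sum>e<length es. if d_edge 2 V es e (vertex_state V x) = Some (edge_state V es i) then 1 else 0)"
    unfolding dcoef_def fst sign by simp
  also have "\<dots> = (\<Sum>e<length es. if e = i then if x \<in> es ! i then 1 else 0 else 0)"
  proof (rule sum.cong[OF refl])
    fix e assume "e \<in> {..<length es}"
    then have e: "e < length es" by simp
    have "edge_state V es e = edge_state V es i \<longleftrightarrow> e = i" by (rule inj_eq[OF inj_edge_state])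
    then show "(if d_edge 2 V es e (vertex_state V x) = Some (edge_state V es i) then 1 else 0) =
      (if e = i then if x \<in> es ! i then 1 else 0 else (0::int))"
      unfolding d_edge_vertex_state[OF assms(1) e assms(3)] by auto
  qed
  also have "\<dots> = (if x \<in> es ! i then 1 else 0)"
    using assms(2) by (subst sum.delta) simp_all
  finally show ?thesis .
qed

lemma dmap_edge_state:
  assumes sg: "simple_graph V es" and i: "i < length es"
  shows "dmap 2 V es 0 (int (card V) - 1) f (edge_state V es i) = (\<Sum>x\<in>es ! i. f (vertex_state V x))"
proof -
  have fin: "finite V" and sub: "es ! i \<subseteq> V" using sg nth_mem[OF i] by (auto simp: simple_graph_def)
  have "edge_state V es i \<in> states 2 V es (Suc 0) (int (card V) - 1)"
    using states_one[OF sg] i by simp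
  then have "dmap 2 V es 0 (int (card V) - 1) f (edge_state V es i) =
    (\<Sum>x\<in>V. f (vertex_state V x) * dcoef 2 V es (vertex_state V x) (edge_state V es i))"
    unfolding dmap_def states_zero[OF fin] by (simp add: sum.reindex[OF inj_vertex_state])
  also have "\<dots> = (\<Sum>x\<in>V. if x \<in> es ! i then f (vertex_state V x) else 0)"
    by (rule sum.cong) (simp_all add: dcoef_vertex_edge[OF sg i])
  also have "\<dots> = (\<Sum>x\<in>es ! i. f (vertex_state V x))"
    using sub fin by (intro sum.mono_neutral_cong_right) auto
  finally show ?thesis .
qed

section \<open>Cochain groups, and coboundaries as edge sums\<close>

lemma cochain_simps:
  "f \<in> carrier (cochain_group m V es i j) \<longleftrightarrow> (\<forall>x. x \<notin> states m V es i j \<longrightarrow> f x = 0)"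
  "f \<otimes>\<^bsub>cochain_group m V es i j\<^esub> g = (\<lambda>x. f x + g x)"
  "\<one>\<^bsub>cochain_group m V es i j\<^esub> = (\<lambda>x. 0)"
  by (simp_all add: cochain_group_def)

lemma group_cochain: "group (cochain_group m V es i j)"
proof (rule groupI)
  fix f assume f: "f \<in> carrier (cochain_group m V es i j)"
  show "\<exists>g\<in>carrier (cochain_group m V es i j). g \<otimes>\<^bsub>cochain_group m V es i j\<^esub> f = \<one>\<^bsub>cochain_group m V es i j\<^esub>"
    by (rule bexI[of _ "\<lambda>x. - f x"]) (use f in \<open>auto simp: cochain_simps\<close>)
qed (auto simp: cochain_simps add.assoc)

lemma group_hom_dmap:
  "group_hom (cochain_group m V es i j) (cochain_group m V es (Suc i) j) (dmap m V es i j)"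
  by (intro group_hom.intro group_hom_axioms.intro group_cochain homI)
    (auto simp: cochain_simps dmap_def distrib_right sum.distrib)

lemma cochain_extension:
  assumes "inj_on \<iota> A" "states m V es i j = \<iota> ` A"
  obtains f where "f \<in> carrier (cochain_group m V es i j)" "\<And>a. a \<in> A \<Longrightarrow> f (\<iota> a) = F a"
proof
  show "(\<lambda>x. if x \<in> \<iota> ` A then F (the_inv_into A \<iota> x) else 0) \<in> carrier (cochain_group m V es i j)"
    using assms(2) by (simp add: cochain_simps)
qed (use assms(1) in \<open>simp add: the_inv_into_f_f\<close>)

text \<open>The edge states are all states of this bidegree, and both sides vanish elsewhere. With
  \<open>g = 0\<close> this describes the cocycles in degree 0, with general \<open>g\<close> the
  coboundaries in degree 1.\<close>

lemma coboundary_eq_iff: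
  assumes sg: "simple_graph V es" and g: "g \<in> carrier (cochain_group 2 V es 1 (int (card V) - 1))"
  shows "g = dmap 2 V es 0 (int (card V) - 1) f \<longleftrightarrow>
    (\<forall>i<length es. g (edge_state V es i) = (\<Sum>x\<in>es ! i. f (vertex_state V x)))"
    (is "_ = ?d \<longleftrightarrow> ?R")
proof
  assume "g = ?d" then show ?R by (simp add: dmap_edge_state[OF sg])
next
  assume R: ?R
  show "g = ?d"
  proof
    fix x show "g x = ?d x"
    proof (cases "x \<in> states 2 V es 1 (int (card V) - 1)")
      case True
      then show ?thesis using R unfolding states_one[OF sg] by (auto simp: dmap_edge_state[OF sg])
    next
      case False
      then have "g x = 0" using g unfolding cochain_simps by blast
      then show ?thesis using False by (simp add: dmap_def)
    qed
  qed
qed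

section \<open>The two cohomology groups\<close>

text \<open>Evaluation at the representatives maps the cocycles onto the free group with trivial
  kernel. As the coboundaries in degree 0 are also trivial, the quotient is covered by the first
  isomorphism theorem.\<close>

lemma cohomology_zero:
  assumes sg: "simple_graph V es"
  shows "cohomology 2 V es 0 (int (card V) - 1) \<cong>
    product_group {..<num_bip_components V es} (\<lambda>_. integer_group)"
proof -
  obtain F \<epsilon> where "signed_forest V es F \<epsilon>" using signed_forest_exists[OF sg] .
  then interpret signed_forest V es F \<epsilon> .
  let ?p = "num_bip_components V es" and ?j = "int (card V) - 1"
  obtain r where r: "\<And>k. k < ?p \<Longrightarrow> r k \<in> V"
    "\<And>z::nat \<Rightarrow> int. \<exists>f. (\<forall>i<length es. sum f (es ! i) = 0) \<and> (\<forall>k<?p. f (r k) = z k)"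
    "\<And>(f::'a \<Rightarrow> int) x. \<lbrakk>\<And>i. i < length es \<Longrightarrow> sum f (es ! i) = 0; \<And>k. k < ?p \<Longrightarrow> f (r k) = 0; x \<in> V\<rbrakk>
      \<Longrightarrow> f x = 0"
    using kernel_coordinates by blast
  let ?G = "cochain_group 2 V es 0 ?j" and ?G' = "cochain_group 2 V es (Suc 0) ?j"
  let ?Z = "cocycles 2 V es 0 ?j" and ?d = "dmap 2 V es 0 ?j"
  let ?H = "product_group {..<?p} (\<lambda>_. integer_group)"
  let ?h = "\<lambda>f. \<lambda>k\<in>{..<?p}. f (vertex_state V (r k)) :: int"
  interpret d: group_hom ?G ?G' ?d by (rule group_hom_dmap)
  have Z_iff: "f \<in> ?Z \<longleftrightarrow> f \<in> carrier ?G \<and> (\<forall>i<length es. (\<Sum>x\<in>es ! i. f (vertex_state V x)) = 0)" for f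
  proof -
    have zero: "(\<lambda>_. 0) \<in> carrier (cochain_group 2 V es 1 ?j)" by (simp add: cochain_simps)
    have "f \<in> ?Z \<longleftrightarrow> f \<in> carrier ?G \<and> (\<lambda>_. 0) = ?d f"
      unfolding cocycles_def kernel_def cochain_simps(3) by auto
    also have "\<dots> \<longleftrightarrow> f \<in> carrier ?G \<and> (\<forall>i<length es. 0 = (\<Sum>x\<in>es ! i. f (vertex_state V x)))"
      by (simp only: coboundary_eq_iff[OF sg zero])
    finally show ?thesis by simp
  qed
  have grp: "group (?G\<lparr>carrier := ?Z\<rparr>)"
    unfolding cocycles_def by (rule d.G.subgroup_imp_group[OF d.subgroup_kernel])
  have hom: "?h \<in> hom (?G\<lparr>carrier := ?Z\<rparr>) ?H"
    by (rule homI) (auto simp: cochain_simps)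
  have "group ?H" by simp
  then interpret h: group_hom "?G\<lparr>carrier := ?Z\<rparr>" ?H ?h
    by (intro group_hom.intro group_hom_axioms.intro grp hom)
  have K: "kernel (?G\<lparr>carrier := ?Z\<rparr>) ?H ?h = {\<lambda>x. 0}"
  proof (intro equalityI subsetI)
    fix f assume "f \<in> kernel (?G\<lparr>carrier := ?Z\<rparr>) ?H ?h"
    then have f: "f \<in> ?Z" "?h f = (\<lambda>k\<in>{..<?p}. 0)" by (simp_all add: kernel_def integer_group_def)
    have null: "(\<Sum>x\<in>es ! i. f (vertex_state V x)) = 0" if "i < length es" for i
      using f(1) that unfolding Z_iff by simp
    have roots: "f (vertex_state V (r k)) = 0" if "k < ?p" for k
      using fun_cong[OF f(2), of k] that by simp
    have on_V: "f (vertex_state V x) = 0" if "x \<in> V" for x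
      by (rule r(3)[of "\<lambda>x. f (vertex_state V x)", OF null roots that])
    have off_V: "f x = 0" if "x \<notin> vertex_state V ` V" for x
      using f(1) that unfolding Z_iff cochain_simps states_zero[OF finV] by blast
    have "f x = 0" for x
    proof (cases "x \<in> vertex_state V ` V")
      case True
      then obtain a where "a \<in> V" "x = vertex_state V a" by blast
      then show ?thesis using on_V by (simp only:)
    qed (rule off_V)
    then show "f \<in> {\<lambda>x. 0}" by (simp add: fun_eq_iff)
  next
    fix f :: "'a state \<Rightarrow> int" assume "f \<in> {\<lambda>x. 0}"
    then show "f \<in> kernel (?G\<lparr>carrier := ?Z\<rparr>) ?H ?h"
      by (simp add: kernel_def Z_iff cochain_simps integer_group_def)
  qed
  have surj: "?h ` carrier (?G\<lparr>carrier := ?Z\<rparr>) = carrier ?H"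
  proof (intro equalityI subsetI)
    fix z assume z: "z \<in> carrier ?H"
    obtain F where F: "\<forall>i<length es. sum F (es ! i) = 0" "\<forall>k<?p. F (r k) = z k"
      using r(2) by blast
    obtain f where f: "f \<in> carrier ?G" "\<And>a. a \<in> V \<Longrightarrow> f (vertex_state V a) = F a"
      using cochain_extension[OF inj_vertex_state states_zero[OF finV], of es F] by blast
    have "(\<Sum>x\<in>es ! i. f (vertex_state V x)) = sum F (es ! i)" if "i < length es" for i
    proof (rule sum.cong[OF refl])
      fix x assume "x \<in> es ! i"
      then have "x \<in> V" using sg nth_mem[OF that] by (auto simp: simple_graph_def)
      then show "f (vertex_state V x) = F x" by (rule f(2))
    qed
    then have "f \<in> ?Z" using f(1) F(1) by (simp add: Z_iff)
    then have "?h f \<in> ?h ` carrier (?G\<lparr>carrier := ?Z\<rparr>)" by (intro imageI) simp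
    moreover have "?h f = restrict z {..<?p}"
      by (rule restrict_ext) (simp add: r(1) f(2) F(2))
    moreover have "restrict z {..<?p} = z" using z by (simp add: PiE_restrict)
    ultimately show "z \<in> ?h ` carrier (?G\<lparr>carrier := ?Z\<rparr>)" by (simp only:)
  qed (elim imageE, hypsubst, rule h.hom_closed)
  have "cohomology 2 V es 0 ?j = (?G\<lparr>carrier := ?Z\<rparr>) Mod kernel (?G\<lparr>carrier := ?Z\<rparr>) ?H ?h"
    unfolding cohomology_def coboundaries_def K by simp
  then show ?thesis using h.FactGroup_iso[OF surj] by (simp only:)
qed

text \<open>The first isomorphism theorem is applied to \<phi> together with \<psi> modulo 2, on all
  1-cochains: their common kernel is the group of coboundaries, and every 1-cochain is a
  cocycle.\<close>

lemma cohomology_one: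
  assumes sg: "simple_graph V es"
  shows "cohomology 2 V es 1 (int (card V) - 1) \<cong> Zfree_plus_Z2
    (nat (cyclomatic V es - (int (num_components V es) - int (num_bip_components V es))))
    (num_components V es - num_bip_components V es)" (is "_ \<cong> Zfree_plus_Z2 ?m ?t")
proof -
  obtain F \<epsilon> where "signed_forest V es F \<epsilon>" using signed_forest_exists[OF sg] .
  then interpret signed_forest V es F \<epsilon> .
  let ?j = "int (card V) - 1"
  obtain \<phi> \<psi> :: "(nat \<Rightarrow> int) \<Rightarrow> nat \<Rightarrow> int" where
    \<phi>: "\<And>g g' k. \<phi> (\<lambda>i. g i + g' i) k = \<phi> g k + \<phi> g' k" and
    \<psi>: "\<And>g g' k. \<psi> (\<lambda>i. g i + g' i) k = \<psi> g k + \<psi> g' k" and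
    onto': "\<And>y z. \<exists>g. (\<forall>k<?m. \<phi> g k = y k) \<and> (\<forall>k<?t. \<psi> g k = z k)" and
    ker: "\<And>g. (\<forall>k<?m. \<phi> g k = 0) \<and> (\<forall>k<?t. even (\<psi> g k)) \<longleftrightarrow> (\<exists>f. \<forall>i<length es. g i = sum f (es ! i))"
    using cokernel_coordinates by blast
  let ?G = "cochain_group 2 V es 0 ?j" and ?G' = "cochain_group 2 V es 1 ?j"
  let ?d = "dmap 2 V es 0 ?j" and ?e = "\<lambda>g i. g (edge_state V es i)"
  let ?A = "product_group {..<?m} (\<lambda>_. integer_group)"
  let ?B = "product_group {..<?t} (\<lambda>_. integer_mod_group 2)"
  let ?h = "\<lambda>g. (\<lambda>k\<in>{..<?m}. \<phi> (?e g) k, \<lambda>k\<in>{..<?t}. \<psi> (?e g) k mod 2)"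
  have grp: "group (?A \<times>\<times> ?B)" by (intro DirProd_group) simp_all
  have hom: "?h \<in> hom ?G' (?A \<times>\<times> ?B)"
    by (rule homI) (auto simp: cochain_simps \<phi> \<psi> carrier_integer_mod_group mod_add_eq fun_eq_iff)
  interpret h: group_hom ?G' "?A \<times>\<times> ?B" ?h
    by (intro group_hom.intro group_hom_axioms.intro group_cochain grp hom)
  have ker_h: "g \<in> kernel ?G' (?A \<times>\<times> ?B) ?h \<longleftrightarrow>
    g \<in> carrier ?G' \<and> (\<exists>f. \<forall>i<length es. ?e g i = sum f (es ! i))" for g
    unfolding ker[symmetric]
    by (auto simp: kernel_def integer_group_def fun_eq_iff restrict_def even_iff_mod_2_eq_zero)
  have K: "kernel ?G' (?A \<times>\<times> ?B) ?h = coboundaries 2 V es 1 ?j"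
  proof (intro equalityI subsetI)
    fix g assume "g \<in> kernel ?G' (?A \<times>\<times> ?B) ?h"
    then obtain F where g: "g \<in> carrier ?G'" and F: "\<forall>i<length es. ?e g i = sum F (es ! i)"
      unfolding ker_h by blast
    obtain f where f: "f \<in> carrier ?G" "\<And>a. a \<in> V \<Longrightarrow> f (vertex_state V a) = F a"
      using cochain_extension[OF inj_vertex_state states_zero[OF finV], of es F] by blast
    have "(\<Sum>x\<in>es ! i. f (vertex_state V x)) = sum F (es ! i)" if "i < length es" for i
    proof (rule sum.cong[OF refl])
      fix x assume "x \<in> es ! i"
      then have "x \<in> V" using sg nth_mem[OF that] by (auto simp: simple_graph_def)
      then show "f (vertex_state V x) = F x" by (rule f(2))
    qed
    then have "g = ?d f" using F by (simp add: coboundary_eq_iff[OF sg g])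
    then show "g \<in> coboundaries 2 V es 1 ?j" using f(1) by (simp add: coboundaries_def)
  next
    fix g assume "g \<in> coboundaries 2 V es 1 ?j"
    then obtain f where g: "g = ?d f" "f \<in> carrier ?G" by (auto simp: coboundaries_def)
    have "g \<in> carrier ?G'" using group_hom.hom_closed[OF group_hom_dmap g(2)] g(1) by simp
    then show "g \<in> kernel ?G' (?A \<times>\<times> ?B) ?h"
      using coboundary_eq_iff[OF sg, of g f] g(1) unfolding ker_h by blast
  qed
  have surj: "?h ` carrier ?G' = carrier (?A \<times>\<times> ?B)"
  proof (intro equalityI subsetI)
    fix yz assume "yz \<in> carrier (?A \<times>\<times> ?B)"
    then obtain y z where yz: "yz = (y, z)" "y \<in> carrier ?A" "z \<in> carrier ?B" by auto
    obtain g' where g': "\<forall>k<?m. \<phi> g' k = y k" "\<forall>k<?t. \<psi> g' k = z k" using onto' by blast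
    obtain g where g: "g \<in> carrier ?G'" "\<And>i. i \<in> {..<length es} \<Longrightarrow> g (edge_state V es i) = g' i"
      using cochain_extension[OF inj_on_subset[OF inj_edge_state subset_UNIV] states_one[OF sg], of g'] by blast
    \<comment> \<open>The function \<open>g'\<close> may have arbitrary values at indices that are
      not edges, which a cochain cannot match. The difference vanishes on all edges, so it is the
      image of 0, and \<open>ker\<close> shows that it changes neither \<phi> nor the parity of
      \<psi>.\<close>
    let ?r = "\<lambda>i. g' i - ?e g i"
    have "\<exists>f. \<forall>i<length es. ?r i = sum f (es ! i)"
      by (rule exI[of _ "\<lambda>_. 0"]) (simp add: g(2))
    then have r: "(\<forall>k<?m. \<phi> ?r k = 0) \<and> (\<forall>k<?t. even (\<psi> ?r k))" unfolding ker .
    have split: "\<phi> g' k = \<phi> (?e g) k + \<phi> ?r k" "\<psi> g' k = \<psi> (?e g) k + \<psi> ?r k" for k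
      using \<phi>[of "?e g" ?r k] \<psi>[of "?e g" ?r k] by simp_all
    have y: "\<phi> (?e g) k = y k" if "k < ?m" for k
    proof -
      have "\<phi> ?r k = 0" "\<phi> g' k = y k" using r g'(1) that by blast+
      then show ?thesis using split(1)[of k] by linarith
    qed
    have z: "\<psi> (?e g) k mod 2 = z k" if "k < ?t" for k
    proof -
      have "even (\<psi> ?r k)" "\<psi> g' k = z k" using r g'(2) that by blast+
      then have "even (\<psi> (?e g) k - z k)" using split(2)[of k] by presburger
      then have "\<psi> (?e g) k mod 2 = z k mod 2" by (simp only: mod_eq_dvd_iff)
      moreover have "z k \<in> carrier (integer_mod_group 2)" using yz(3) that by auto
      ultimately show ?thesis by (simp add: carrier_integer_mod_group)
    qed
    have "(\<lambda>k\<in>{..<?m}. \<phi> (?e g) k) = restrict y {..<?m}"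
      by (rule restrict_ext) (simp only: y lessThan_iff)
    moreover have "(\<lambda>k\<in>{..<?t}. \<psi> (?e g) k mod 2) = restrict z {..<?t}"
      by (rule restrict_ext) (simp only: z lessThan_iff)
    moreover have "restrict y {..<?m} = y" "restrict z {..<?t} = z" using yz(2,3) by (simp_all add: PiE_restrict)
    ultimately have "?h g = yz" unfolding yz(1) by (simp only:)
    moreover have "?h g \<in> ?h ` carrier ?G'" using g(1) by (rule imageI)
    ultimately show "yz \<in> ?h ` carrier ?G'" by (simp only:)
  qed (elim imageE, hypsubst, rule h.hom_closed)
  \<comment> \<open>There is no state on two edges in this degree, so the next differential is
    zero.\<close>
  have "dmap 2 V es 1 ?j g = (\<lambda>x. 0)" for g
    using states_two[OF sg] by (simp add: dmap_def numeral_2_eq_2)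
  then have "cocycles 2 V es 1 ?j = carrier ?G'"
    by (simp add: cocycles_def kernel_def cochain_simps(3))
  then have "cohomology 2 V es 1 ?j = ?G' Mod kernel ?G' (?A \<times>\<times> ?B) ?h"
    unfolding cohomology_def K by simp
  then show ?thesis
    using h.FactGroup_iso[OF surj] unfolding Zfree_plus_Z2_def by (simp only:)
qed

theorem theorem3p1:
  fixes V :: "'v set" and es :: "'v set list"
  assumes "simple_graph V es"
  shows "(cohomology 2 V es 0 (int (card V) - 1)
           \<cong> product_group {..<num_bip_components V es} (\<lambda>_. integer_group)) \<and>
         (cohomology 2 V es 1 (int (card V) - 1)
           \<cong> Zfree_plus_Z2
               (nat (cyclomatic V es - (int (num_components V es) - int (num_bip_components V es))))
               (num_components V es - num_bip_components V es))"
  using cohomology_zero[OF assms] cohomology_one[OF assms] ..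

end
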